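(* Let $m \geq \ell \geq 2$, let $n \geq 0$, and let $d$ be an integer. For every set of leaves $B \subseteq m^n$ with $\mathrm{LTD}_\ell(B) \leq d$, \[ |B| \leq \sum_{i=0}^{d} \binom{n}{i} (m-\ell+1)^i (\ell-1)^{n-i}. \]
   Context: For integers $m \geq 2$ and $k \geq 0$, $m^{\leq k}$ is the set of sequences of length at most $k$ with entries in $\{0,\dots,m-1\}$, and $m^k$ is the set of those of length exactly $k$. Elements of $m^n$ are called leaves. Write $a \prec b$ if $a$ is a proper initial segment of $b$. The meet $a \wedge b$ is the longest common initial segment of $a$ and $b$. Write $a \sim b$ if $|a| = |b|$. For $B \subseteq m^n$, $\check B$ is the set of all initial segments, including the sequences themselves, of elements of $B$. The leveled $\ell$-ary tree of height $d$ is $\widetilde T_{d,\ell} = (\ell^{\leq d}, \prec, \wedge, \sim)$. An embedding $f$ of $(A,\prec,\wedge,\sim)$ into $(A',\prec,\wedge,\sim)$ is an injective map satisfying, for all $a,a' \in A$: - $a \prec a'$ iff $f(a) \prec f(a')$; - $f(a \wedge a') = f(a) \wedge f(a')$; - $a \sim a'$ iff $f(a) \sim f(a')$. For nonempty $B \subseteq m^n$, the leveled $\ell$-ary tree dimension $\mathrm{LTD}_\ell(B)$ is the largest nonnegative integer $d$ such that $\widetilde T_{d,\ell}$ embeds in $(\check B, \prec, \wedge, \sim)$. Set $\mathrm{LTD}_\ell(\emptyset) = -1$. Binomial coefficients $\binom{n}{i}$ with $i > n$ are $0$. *)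

theory Defs
  imports "HOL-Library.Sublist"
begin

text \<open>
  Finite sequences are lists. The relation "initial segment" is \<^const>\<open>prefix\<close>, its strict
  part is \<^const>\<open>strict_prefix\<close>, and the meet of two sequences is
  \<^const>\<open>longest_common_prefix\<close>.
\<close>

definition seqs_upto :: "nat \<Rightarrow> nat \<Rightarrow> nat list set" where
  "seqs_upto m k = {xs. set xs \<subseteq> {..<m} \<and> length xs \<le> k}"

definition leaves :: "nat \<Rightarrow> nat \<Rightarrow> nat list set" where
  "leaves m n = {xs. set xs \<subseteq> {..<m} \<and> length xs = n}"

definition initial_segments :: "'a list set \<Rightarrow> 'a list set" where
  "initial_segments B = {xs. \<exists>b\<in>B. prefix xs b}"

definition same_level :: "'a list \<Rightarrow> 'b list \<Rightarrow> bool" where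
  "same_level a b \<longleftrightarrow> length a = length b"

text \<open>
  The structure on a set of sequences is the one inherited from the ambient lists; the sets
  \<^term>\<open>seqs_upto l d\<close> and \<^term>\<open>initial_segments B\<close> it is used for are closed under meets.
\<close>

definition leveled_embedding ::
  "('a list \<Rightarrow> 'b list) \<Rightarrow> 'a list set \<Rightarrow> 'b list set \<Rightarrow> bool" where
  "leveled_embedding f A A' \<longleftrightarrow>
     f ` A \<subseteq> A' \<and> inj_on f A \<and>
     (\<forall>a\<in>A. \<forall>a'\<in>A.
        (strict_prefix a a' \<longleftrightarrow> strict_prefix (f a) (f a')) \<and>
        f (longest_common_prefix a a') = longest_common_prefix (f a) (f a') \<and>
        (same_level a a' \<longleftrightarrow> same_level (f a) (f a')))"

definition leveled_embeds :: "'a list set \<Rightarrow> 'b list set \<Rightarrow> bool" where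
  "leveled_embeds A A' \<longleftrightarrow> (\<exists>f. leveled_embedding f A A')"

text \<open>
  For nonempty \<open>B \<subseteq> leaves m n\<close> and \<open>l \<ge> 1\<close> the greatest element below exists, by
  \<open>leveled_embeds_0\<close> and \<open>leveled_embeds_bound\<close>.
\<close>

definition LTD :: "nat \<Rightarrow> nat list set \<Rightarrow> int" where
  "LTD l B =
     (if B = {} then -1
      else int (GREATEST d. leveled_embeds (seqs_upto l d) (initial_segments B)))"

lemma leveled_embeds_0:
  assumes "B \<noteq> {}"
  shows "leveled_embeds (seqs_upto l 0) (initial_segments B)"
proof -
  have "leveled_embedding (\<lambda>_. []) (seqs_upto l 0) (initial_segments B)"
    using assms by (auto simp: leveled_embedding_def seqs_upto_def initial_segments_def
        same_level_def inj_on_def)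
  then show ?thesis unfolding leveled_embeds_def by blast
qed

lemma leveled_embeds_bound:
  assumes l: "l \<ge> 1" and B: "B \<subseteq> leaves m n"
    and e: "leveled_embeds (seqs_upto l d) (initial_segments B)"
  shows "d \<le> n"
proof -
  obtain f where f: "leveled_embedding f (seqs_upto l d) (initial_segments B)"
    using e unfolding leveled_embeds_def by blast
  have mem: "replicate i 0 \<in> seqs_upto l d" if "i \<le> d" for i
    using that l by (auto simp: seqs_upto_def)
  have long: "i \<le> length (f (replicate i 0))" if "i \<le> d" for i
    using that
  proof (induction i)
    case (Suc i)
    have "strict_prefix (replicate i (0::nat)) (replicate (Suc i) 0)"
      by (metis lessI length_replicate nless_le prefix_order.order_iff_strict
          replicate_append_same prefixI replicate_Suc)
    then have "strict_prefix (f (replicate i 0)) (f (replicate (Suc i) 0))"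
      using f mem[of i] mem[of "Suc i"] Suc.prems unfolding leveled_embedding_def by auto
    then have "length (f (replicate i 0)) < length (f (replicate (Suc i) 0))"
      by (rule prefix_length_less)
    with Suc show ?case by simp
  qed simp
  have "f (replicate d 0) \<in> initial_segments B"
    using f mem[of d] unfolding leveled_embedding_def by auto
  then obtain b where "b \<in> B" "prefix (f (replicate d 0)) b"
    unfolding initial_segments_def by auto
  then have "length (f (replicate d 0)) \<le> n"
    using B prefix_length_le unfolding leaves_def by fastforce
  with long[of d] show ?thesis by simp
qed

end

theory Submission
  imports Defs
begin

text \<open>
  Sort embedded leveled trees by the set of levels at which they branch, and charge
  \<open>m - l + 1\<close> to every branching level and \<open>l - 1\<close> to every other one. Then \<open>card B\<close> is at most
  the total weight of the level sets realised in \<open>B\<close>. Indeed, split \<open>B\<close> by the first letter and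
  fix a set \<open>S\<close> of later levels: if at most \<open>l - 1\<close> of the parts realise \<open>S\<close>, this is paid for by
  the level set that does not branch at the top, and if at least \<open>l\<close> parts do, then branching
  at the top is possible too, and the two weights add up to \<open>m\<close>.
\<close>

section \<open>Shattered level sets and their branching levels\<close>

text \<open>
  A set of levels is encoded by its characteristic list of booleans.
\<close>

fun shatters :: "nat \<Rightarrow> bool list \<Rightarrow> 'a list set \<Rightarrow> bool" where
  "shatters l [] B \<longleftrightarrow> [] \<in> B"
| "shatters l (False # s) B \<longleftrightarrow> (\<exists>a. shatters l s {xs. a # xs \<in> B})"
| "shatters l (True # s) B \<longleftrightarrow> (\<exists>A. card A = l \<and> (\<forall>a\<in>A. shatters l s {xs. a # xs \<in> B}))"

text \<open>
  The level of the \<open>k\<close>-th \<^const>\<open>True\<close>; the values beyond the last one are chosen to make the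
  function strictly monotone everywhere.
\<close>

fun branch_level :: "bool list \<Rightarrow> nat \<Rightarrow> nat" where
  "branch_level [] k = k"
| "branch_level (False # s) k = Suc (branch_level s k)"
| "branch_level (True # s) 0 = 0"
| "branch_level (True # s) (Suc k) = Suc (branch_level s k)"

text \<open>Injectivity of \<open>branch_level s\<close> follows, and with it a map sending length
  \<open>k\<close> to level \<open>branch_level s k\<close> both preserves and reflects
  \<open>same_level\<close>.\<close>

lemma strict_mono_branch_level: "strict_mono (branch_level s)"
proof (rule strict_monoI)
  show "branch_level s i < branch_level s j" if "i < j" for i j
    using that
  proof (induction s i arbitrary: j rule: branch_level.induct)
    case (3 s)
    then show ?case by (cases j) auto
  next
    case (4 s k)
    then show ?case by (cases j) auto
  qed auto
qed

lemma branch_level_eq_iff [simp]: "branch_level s i = branch_level s j \<longleftrightarrow> i = j"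
  by (rule strict_mono_eq[OF strict_mono_branch_level])

text \<open>At a \<open>True\<close> level, \<open>l \<ge> 1\<close> supplies a letter to follow;
  for \<open>l = 0\<close> the empty set of letters would do, even with \<open>B\<close>
  empty.\<close>

lemma shatters_imp_nonempty:
  assumes "l \<ge> 1" and "shatters l s B"
  shows "B \<noteq> {}"
  using assms
proof (induction l s B rule: shatters.induct)
  case (3 l s B)
  then obtain A where A: "card A = l" "\<And>a. a \<in> A \<Longrightarrow> {xs. a # xs \<in> B} \<noteq> {}"
    by auto
  with "3.prems"(1) have "A \<noteq> {}" by auto
  then obtain a where "a \<in> A" by blast
  with A(2) show ?case by auto
qed auto

section \<open>From shattered level sets to leveled embeddings\<close>

lemma Cons_mem_initial_segments:
  "a # xs \<in> initial_segments B \<longleftrightarrow> xs \<in> initial_segments {ys. a # ys \<in> B}"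
  by (auto simp: initial_segments_def prefix_def)

lemma Nil_mem_initial_segments: "[] \<in> initial_segments B \<longleftrightarrow> B \<noteq> {}"
  by (auto simp: initial_segments_def)

lemma prefix_iff_longest_common_prefix:
  "prefix xs ys \<longleftrightarrow> longest_common_prefix xs ys = xs"
  using longest_common_prefix_max_prefix[of xs xs ys] longest_common_prefix_prefix1[of xs ys]
    longest_common_prefix_prefix2[of xs ys] prefix_order.antisym by auto

text \<open>Meets determine the order, so preserving meets preserves prefixes. Conversely, if the
  meet of \<open>x\<close> and \<open>y\<close> has the same image as \<open>x\<close>, the level
  condition gives it the length of \<open>x\<close>, so it is \<open>x\<close>. Injectivity is then
  antisymmetry.\<close>

lemma leveled_embeddingI:
  assumes f: "f ` A \<subseteq> A'"
    and closed: "\<And>x y. x \<in> A \<Longrightarrow> y \<in> A \<Longrightarrow> longest_common_prefix x y \<in> A"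
    and meet: "\<And>x y. x \<in> A \<Longrightarrow> y \<in> A \<Longrightarrow>
      f (longest_common_prefix x y) = longest_common_prefix (f x) (f y)"
    and len: "\<And>x y. x \<in> A \<Longrightarrow> y \<in> A \<Longrightarrow> length (f x) = length (f y) \<longleftrightarrow> length x = length y"
  shows "leveled_embedding f A A'"
proof -
  have prefix: "prefix x y \<longleftrightarrow> prefix (f x) (f y)" if xy: "x \<in> A" "y \<in> A" for x y
  proof
    assume "prefix x y"
    then show "prefix (f x) (f y)"
      using meet[OF xy] by (simp add: prefix_iff_longest_common_prefix)
  next
    assume "prefix (f x) (f y)"
    then have "f (longest_common_prefix x y) = f x"
      using meet[OF xy] by (simp add: prefix_iff_longest_common_prefix)
    then have "length (longest_common_prefix x y) = length x"
      using len[OF closed[OF xy] xy(1)] by simp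
    then have "longest_common_prefix x y = x"
      using longest_common_prefix_prefix1[of x y]
      by (metis append_eq_append_conv append_Nil2 prefix_def)
    then show "prefix x y"
      by (simp add: prefix_iff_longest_common_prefix)
  qed
  have inj: "x = y" if "x \<in> A" "y \<in> A" "f x = f y" for x y
    using that prefix by (metis prefix_order.eq_iff)
  show ?thesis
    unfolding leveled_embedding_def same_level_def
    using f meet len prefix inj by (auto simp: inj_on_def strict_prefix_def)
qed

lemma longest_common_prefix_seqs_upto:
  assumes "xs \<in> seqs_upto l d"
  shows "longest_common_prefix xs ys \<in> seqs_upto l d"
  using assms set_mono_prefix[OF longest_common_prefix_prefix1[of xs ys]]
    prefix_length_le[OF longest_common_prefix_prefix1[of xs ys]]
  unfolding seqs_upto_def by auto

text \<open>A \<open>False\<close> level pushes the whole tree below one letter; a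
  \<open>True\<close> level glues \<open>l\<close> trees under a new root. The length formula
  depends only on \<open>s\<close> and \<open>length x\<close>, so the trees chosen independently
  below different letters agree on levels.\<close>

lemma shatters_imp_meet_preserving_map:
  assumes l: "l \<ge> 1" and "shatters l s B"
  shows "\<exists>f. f ` seqs_upto l (count_list s True) \<subseteq> initial_segments B \<and>
    (\<forall>x\<in>seqs_upto l (count_list s True). length (f x) = branch_level s (length x)) \<and>
    (\<forall>x\<in>seqs_upto l (count_list s True). \<forall>y\<in>seqs_upto l (count_list s True).
       f (longest_common_prefix x y) = longest_common_prefix (f x) (f y))"
  using assms(2)
proof (induction s arbitrary: B)
  case Nil
  then show ?case
    by (intro exI[of _ "\<lambda>_. []"]) (auto simp: seqs_upto_def Nil_mem_initial_segments)
next
  case (Cons b s)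
  let ?D = "seqs_upto l (count_list s True)"
  show ?case
  proof (cases b)
    case False
    then obtain a where "shatters l s {xs. a # xs \<in> B}"
      using Cons.prems by auto
    from Cons.IH[OF this] obtain f
      where f: "f ` ?D \<subseteq> initial_segments {xs. a # xs \<in> B}"
        "\<forall>x\<in>?D. length (f x) = branch_level s (length x)"
        "\<forall>x\<in>?D. \<forall>y\<in>?D. f (longest_common_prefix x y) = longest_common_prefix (f x) (f y)"
      by blast
    with False show ?thesis
      by (intro exI[of _ "\<lambda>x. a # f x"]) (auto simp: Cons_mem_initial_segments)
  next
    case True
    then obtain A where A: "card A = l" and sh: "\<forall>a\<in>A. shatters l s {xs. a # xs \<in> B}"
      using Cons.prems by auto
    \<comment> \<open>An infinite set has \<open>card\<close> 0, which \<open>l \<ge> 1\<close>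
      excludes.\<close>
    have "finite A"
      using A l by (metis card.infinite not_one_le_zero)
    then obtain g where g: "bij_betw g {..<l} A"
      using A by (metis atLeast0LessThan ex_bij_betw_nat_finite)
    have "\<forall>a\<in>A. \<exists>f. f ` ?D \<subseteq> initial_segments {xs. a # xs \<in> B} \<and>
        (\<forall>x\<in>?D. length (f x) = branch_level s (length x)) \<and>
        (\<forall>x\<in>?D. \<forall>y\<in>?D. f (longest_common_prefix x y) = longest_common_prefix (f x) (f y))"
      using Cons.IH sh by blast
    then obtain F where F: "\<And>a x. a \<in> A \<Longrightarrow> x \<in> ?D \<Longrightarrow> F a x \<in> initial_segments {xs. a # xs \<in> B}"
        "\<And>a x. a \<in> A \<Longrightarrow> x \<in> ?D \<Longrightarrow> length (F a x) = branch_level s (length x)"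
        "\<And>a x y. a \<in> A \<Longrightarrow> x \<in> ?D \<Longrightarrow> y \<in> ?D \<Longrightarrow>
          F a (longest_common_prefix x y) = longest_common_prefix (F a x) (F a y)"
      unfolding bchoice_iff image_subset_iff by blast
    \<comment> \<open>The root stays at \<open>[]\<close>, and branch \<open>i\<close> uses the
      letter \<open>g i\<close> and the map chosen for it. As \<open>g\<close> is injective, nodes
      in different branches and their images both meet in \<open>[]\<close>.\<close>
    define f where "f = (\<lambda>x. case x of [] \<Rightarrow> [] | i # y \<Rightarrow> g i # F (g i) y)"
    have f_simps [simp]: "f [] = []" "f (i # y) = g i # F (g i) y" for i y
      by (simp_all add: f_def)
    have gA: "g i \<in> A" if "i < l" for i
      using g that by (auto simp: bij_betw_def)
    have g_eq: "g i = g j \<longleftrightarrow> i = j" if "i < l" "j < l" for i j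
      using g that by (auto simp: bij_betw_def inj_on_def)
    define E where "E = seqs_upto l (count_list (b # s) True)"
    have E: "i # y \<in> E \<longleftrightarrow> i < l \<and> y \<in> ?D" for i y
      using True by (auto simp: E_def seqs_upto_def)
    have "B \<noteq> {}"
      using shatters_imp_nonempty[OF l Cons.prems] .
    then have "f x \<in> initial_segments B" if "x \<in> E" for x
      using that by (cases x) (auto simp: E F gA Cons_mem_initial_segments Nil_mem_initial_segments)
    moreover have "length (f x) = branch_level (b # s) (length x)" if "x \<in> E" for x
      using that True by (cases x) (auto simp: E F gA)
    moreover have "f (longest_common_prefix x y) = longest_common_prefix (f x) (f y)" if "x \<in> E" "y \<in> E" for x y
      using that by (cases x; cases y) (auto simp: E F gA g_eq)
    ultimately show ?thesis unfolding E_def by blast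
  qed
qed

lemma shatters_imp_leveled_embeds:
  assumes "l \<ge> 1" and "shatters l s B"
  shows "leveled_embeds (seqs_upto l (count_list s True)) (initial_segments B)"
proof -
  obtain f where "f ` seqs_upto l (count_list s True) \<subseteq> initial_segments B"
    "\<forall>x\<in>seqs_upto l (count_list s True). length (f x) = branch_level s (length x)"
    "\<forall>x\<in>seqs_upto l (count_list s True). \<forall>y\<in>seqs_upto l (count_list s True).
       f (longest_common_prefix x y) = longest_common_prefix (f x) (f y)"
    using shatters_imp_meet_preserving_map[OF assms] by blast
  then have "leveled_embedding f (seqs_upto l (count_list s True)) (initial_segments B)"
    by (intro leveled_embeddingI) (auto simp: longest_common_prefix_seqs_upto)
  then show ?thesis unfolding leveled_embeds_def by blast
qed

lemma shatters_imp_le_LTD: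
  assumes l: "l \<ge> 1" and B: "B \<subseteq> leaves m n" and s: "shatters l s B"
  shows "int (count_list s True) \<le> LTD l B"
proof -
  \<comment> \<open>The bound \<open>n\<close> on embeddable depths makes \<open>GREATEST\<close> an
    actual maximum.\<close>
  have "count_list s True \<le> (GREATEST d. leveled_embeds (seqs_upto l d) (initial_segments B))"
    using shatters_imp_leveled_embeds[OF l s] leveled_embeds_bound[OF l B]
    by (rule Greatest_le_nat)
  with shatters_imp_nonempty[OF l s] show ?thesis by (simp add: LTD_def)
qed

section \<open>Boolean lists and binomial coefficients\<close>

lemma finite_bool_lists: "finite {s :: bool list. length s = n}"
  using finite_lists_length_eq[of "UNIV :: bool set" n] by simp

lemma bool_lists_Suc:
  "{s :: bool list. length s = Suc n} =
    (#) True ` {s. length s = n} \<union> (#) False ` {s. length s = n}"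
proof -
  have "s \<in> (#) True ` {s. length s = n} \<union> (#) False ` {s. length s = n}"
    if "length s = Suc n" for s
    using that by (cases s; cases "hd s") auto
  then show ?thesis by auto
qed

lemma sum_bool_lists_Suc:
  fixes h :: "bool list \<Rightarrow> 'a::comm_monoid_add"
  shows "(\<Sum>s | length s = Suc n. h s) = (\<Sum>s | length s = n. h (True # s) + h (False # s))"
  unfolding bool_lists_Suc
  by (subst sum.union_disjoint)
    (auto simp: finite_bool_lists sum.reindex sum.distrib)

lemma card_bool_lists_count_True:
  "card {s. length s = n \<and> count_list s True = k} = n choose k"
proof (induction n arbitrary: k)
  case 0
  have "{s. length s = 0 \<and> count_list s True = k} = (if k = 0 then {[]} else {})" by auto
  then show ?case by (cases k) simp_all
next
  case (Suc n)
  \<comment> \<open>As a sum of indicators, the cardinality splits by the first entry, which yields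
    Pascal's rule.\<close>
  have card_sum: "card {s. length s = n \<and> count_list s True = k} =
      (\<Sum>s | length s = n. of_bool (count_list s True = k))" for n k
    by (simp add: finite_bool_lists Int_def)
  show ?case
    unfolding card_sum sum_bool_lists_Suc sum.distrib
    using Suc.IH[of k] Suc.IH[of "k - 1"] unfolding card_sum
    by (cases k) simp_all
qed

lemma count_list_True_False: "count_list s True + count_list s False = length s"
  by (induction s) auto

section \<open>The weighted counting inequality\<close>

lemma leaves_after_first_letter:
  assumes "B \<subseteq> leaves m (Suc n)"
  shows "{xs. a # xs \<in> B} \<subseteq> leaves m n"
proof
  fix xs assume "xs \<in> {xs. a # xs \<in> B}"
  with assms have "a # xs \<in> leaves m (Suc n)" by blast
  then show "xs \<in> leaves m n" by (simp add: leaves_def)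
qed

lemma card_first_letter:
  assumes "B \<subseteq> leaves m (Suc n)"
  shows "card B = (\<Sum>a<m. card {xs. a # xs \<in> B})"
proof -
  have fin: "finite {xs. a # xs \<in> B}" for a
    by (rule finite_subset[OF leaves_after_first_letter[OF assms]])
      (simp add: leaves_def finite_lists_length_eq)
  have "bij_betw (\<lambda>(a, xs). a # xs) (SIGMA a:{..<m}. {xs. a # xs \<in> B}) B"
  proof (rule bij_betw_imageI)
    show "(\<lambda>(a, xs). a # xs) ` (SIGMA a:{..<m}. {xs. a # xs \<in> B}) = B"
    proof (intro equalityI subsetI)
      fix x assume "x \<in> B"
      with assms show "x \<in> (\<lambda>(a, xs). a # xs) ` (SIGMA a:{..<m}. {xs. a # xs \<in> B})"
        by (cases x) (force simp: leaves_def)+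
    qed auto
  qed (auto simp: inj_on_def)
  then have "card (SIGMA a:{..<m}. {xs. a # xs \<in> B}) = card B"
    by (rule bij_betw_same_card)
  with fin show ?thesis by simp
qed

text \<open>At least \<open>l\<close> shattering letters make both indicators 1 and the right-hand
  side \<open>m\<close>; with fewer, but at least one, the second indicator alone contributes
  \<open>l - 1\<close>.\<close>

lemma count_shattering_letters_le:
  assumes l: "l \<ge> 1" "l \<le> m"
  shows "(\<Sum>a<m. of_bool (shatters l s {xs. a # xs \<in> B})) \<le>
    of_bool (shatters l (True # s) B) * (m - l + 1) + of_bool (shatters l (False # s) B) * (l - 1)"
proof -
  define A where "A = {a \<in> {..<m}. shatters l s {xs. a # xs \<in> B}}"
  have fin: "finite A" and le: "card A \<le> m"
    using card_mono[of "{..<m}" A] by (auto simp: A_def)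
  have "(\<Sum>a<m. of_bool (shatters l s {xs. a # xs \<in> B})) = card A"
    by (simp add: A_def Int_def)
  also have "\<dots> \<le> of_bool (shatters l (True # s) B) * (m - l + 1) +
      of_bool (shatters l (False # s) B) * (l - 1)"
  proof (cases "A = {}")
    case False
    then have F: "shatters l (False # s) B" by (auto simp: A_def)
    show ?thesis
    proof (cases "l \<le> card A")
      case True
      then obtain A' where "A' \<subseteq> A" "card A' = l"
        using fin by (meson obtain_subset_with_card_n)
      then have "shatters l (True # s) B" by (auto simp: A_def)
      with F le l show ?thesis by simp
    qed (use F in simp)
  qed simp
  finally show ?thesis .
qed

text \<open>A weighted tree analogue of Pajor's inequality: for \<open>m = l = 2\<close> all weights
  are 1 and the right-hand side counts the shattered level sets.\<close>

lemma card_le_sum_shatters: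
  assumes l: "l \<ge> 1" "l \<le> m" and "B \<subseteq> leaves m n"
  shows "card B \<le> (\<Sum>s | length s = n. of_bool (shatters l s B) *
    ((m - l + 1) ^ count_list s True * (l - 1) ^ count_list s False))"
  using assms(3)
proof (induction n arbitrary: B)
  case 0
  then have "B = {} \<or> B = {[]}" by (auto simp: leaves_def)
  then show ?case by auto
next
  case (Suc n)
  define w where
    "w s = (m - l + 1) ^ count_list s True * (l - 1) ^ count_list s False" for s
  have w_Cons: "w (True # s) = (m - l + 1) * w s" "w (False # s) = (l - 1) * w s" for s
    by (simp_all add: w_def algebra_simps)
  have "card B = (\<Sum>a<m. card {xs. a # xs \<in> B})"
    by (rule card_first_letter[OF Suc.prems])
  also have "\<dots> \<le> (\<Sum>a<m. \<Sum>s | length s = n. of_bool (shatters l s {xs. a # xs \<in> B}) * w s)"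
  proof (intro sum_mono)
    fix a
    from Suc.IH[OF leaves_after_first_letter[OF Suc.prems]]
    show "card {xs. a # xs \<in> B} \<le>
        (\<Sum>s | length s = n. of_bool (shatters l s {xs. a # xs \<in> B}) * w s)"
      by (simp only: w_def)
  qed
  \<comment> \<open>After the swap, the inner sum counts the first letters that shatter a fixed
    \<open>s\<close>.\<close>
  also have "\<dots> = (\<Sum>s | length s = n. (\<Sum>a<m. of_bool (shatters l s {xs. a # xs \<in> B})) * w s)"
    by (subst sum.swap) (simp only: sum_distrib_right)
  also have "\<dots> \<le> (\<Sum>s | length s = n. (of_bool (shatters l (True # s) B) * (m - l + 1) +
      of_bool (shatters l (False # s) B) * (l - 1)) * w s)"
    by (intro sum_mono mult_right_mono count_shattering_letters_le l) simp
  also have "\<dots> = (\<Sum>s | length s = Suc n. of_bool (shatters l s B) * w s)"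
    unfolding sum_bool_lists_Suc w_Cons by (simp only: distrib_right mult.assoc)
  finally show ?case by (simp only: w_def)
qed

section \<open>Summation by the number of branching levels\<close>

theorem theorem2p2:
  fixes m l n :: nat and d :: int and B :: "nat list set"
  assumes "2 \<le> l" and "l \<le> m"
    and "B \<subseteq> leaves m n"
    and "LTD l B \<le> d"
  shows "card B \<le> (\<Sum>i\<in>{i::nat. int i \<le> d}. (n choose i) * (m - l + 1) ^ i * (l - 1) ^ (n - i))"
proof -
  have l: "l \<ge> 1" using assms(1) by simp
  \<comment> \<open>For negative \<open>d\<close> this is empty, matching
    \<open>LTD l {} = -1\<close>.\<close>
  define I where "I = {i::nat. int i \<le> d}"
  define S where "S = {s. length s = n \<and> count_list s True \<in> I}"
  have finI: "finite I"
    by (rule finite_subset[of _ "{..nat d}"]) (auto simp: I_def)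
  have finS: "finite S"
    by (rule finite_subset[OF _ finite_bool_lists[of n]]) (auto simp: S_def)
  have "card B \<le> (\<Sum>s | length s = n. of_bool (shatters l s B) *
      ((m - l + 1) ^ count_list s True * (l - 1) ^ count_list s False))"
    by (rule card_le_sum_shatters[OF l assms(2,3)])
  \<comment> \<open>A shattered \<open>s\<close> has at most \<open>LTD l B \<le> d\<close>
    branching levels, so terms outside \<open>S\<close> vanish.\<close>
  also have "\<dots> = (\<Sum>s\<in>S. of_bool (shatters l s B) *
      ((m - l + 1) ^ count_list s True * (l - 1) ^ count_list s False))"
    using shatters_imp_le_LTD[OF l assms(3)] assms(4)
    by (intro sum.mono_neutral_right finite_bool_lists) (force simp: S_def I_def)+
  \<comment> \<open>Without the indicators, a term depends only on the number of \<open>True\<close>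
    entries, so grouping by that number produces the binomial coefficients.\<close>
  also have "\<dots> \<le> (\<Sum>s\<in>S. (m - l + 1) ^ count_list s True * (l - 1) ^ count_list s False)"
    by (intro sum_mono) simp
  also have "\<dots> = (\<Sum>i\<in>I. \<Sum>s | s \<in> S \<and> count_list s True = i.
      (m - l + 1) ^ count_list s True * (l - 1) ^ count_list s False)"
    by (intro sum.group[symmetric] finS finI) (auto simp: S_def)
  also have "\<dots> = (\<Sum>i\<in>I. (n choose i) * (m - l + 1) ^ i * (l - 1) ^ (n - i))"
  proof (intro sum.cong refl)
    fix i assume "i \<in> I"
    then have eq: "{s. s \<in> S \<and> count_list s True = i} =
        {s. length s = n \<and> count_list s True = i}"
      by (auto simp: S_def)
    have "count_list s False = n - i" if "length s = n" "count_list s True = i" for s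
      using count_list_True_False[of s] that by simp
    then have "(\<Sum>s | s \<in> S \<and> count_list s True = i.
        (m - l + 1) ^ count_list s True * (l - 1) ^ count_list s False) =
        (\<Sum>s | length s = n \<and> count_list s True = i. (m - l + 1) ^ i * (l - 1) ^ (n - i))"
      unfolding eq by (intro sum.cong) auto
    then show "(\<Sum>s | s \<in> S \<and> count_list s True = i.
        (m - l + 1) ^ count_list s True * (l - 1) ^ count_list s False) =
        (n choose i) * (m - l + 1) ^ i * (l - 1) ^ (n - i)"
      by (simp add: card_bool_lists_count_True)
  qed
  finally show ?thesis unfolding I_def .
qed

end
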